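(* Let $H$ be a real Hilbert space, $I\ge 1$ an integer and $\mathcal{I}=\{1,\dots,I\}$. For each $i\in\mathcal{I}$ let $T^{(i)}\colon H\to H$ be firmly nonexpansive, with $X:=\bigcap_{i\in\mathcal{I}}\mathrm{Fix}(T^{(i)})\neq\emptyset$, and let $f^{(i)}\colon H\to\mathbb{R}$ be continuous and convex; put $f:=\sum_{i\in\mathcal{I}}f^{(i)}$. Let $(\alpha_n)_{n\in\mathbb{N}}\subset(0,1]$ and $(\gamma_n)_{n\in\mathbb{N}}\subset(0,\infty)$ both converge to $0$ and satisfy $$\sum_{n=0}^\infty\alpha_n=\infty,\quad \lim_{n\to\infty}\frac{1}{\alpha_{n+1}}\left|\frac{1}{\gamma_{n+1}}-\frac{1}{\gamma_n}\right|=0,\quad \lim_{n\to\infty}\frac{1}{\gamma_{n+1}}\left|1-\frac{\alpha_n}{\alpha_{n+1}}\right|=0,$$ $$\lim_{n\to\infty}\frac{1}{\alpha_{n+1}}\frac{|\gamma_{n+1}-\gamma_n|}{\gamma_{n+1}^2}=0,\quad \lim_{n\to\infty}\frac{\alpha_n}{\gamma_n}=0.$$ Let $x^{(i)}\in H$ ($i\in\mathcal{I}$) and $x_0\in H$ be arbitrary, and for $n\in\mathbb{N}$ define $x_n^{(0)}:=x_n$ and, for $i=1,2,\dots,I$, $$y_n^{(i)}:=\mathrm{Prox}_{\gamma_n f^{(i)}}\left(x_n^{(i-1)}\right),\qquad x_n^{(i)}:=\alpha_n x^{(i)}+(1-\alpha_n)T^{(i)}\left(y_n^{(i)}\right),$$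 and $x_{n+1}:=x_n^{(I)}$. Assume that the sequence $(y_n^{(i)})_{n\in\mathbb{N}}$ is bounded for every $i\in\mathcal{I}$. Then, for every $i\in\mathcal{I}$, any weak sequential cluster point of $(x_n^{(i)})_{n\in\mathbb{N}}$ belongs to the solution set $\{x\in X\colon f(x)\le f(z)\text{ for all }z\in X\}$ of the problem of minimizing $f$ over $X$.
   Context: $\mathbb{N}$ denotes the nonnegative integers. $\mathrm{Fix}(T)=\{x\in H\colon T(x)=x\}$. A mapping $T\colon H\to H$ is firmly nonexpansive if $\|T(x)-T(y)\|^2+\|(\mathrm{Id}-T)(x)-(\mathrm{Id}-T)(y)\|^2\le\|x-y\|^2$ for all $x,y\in H$. For a proper, lower semicontinuous, convex function $g$ on $H$, $\mathrm{Prox}_g(x)$ is the unique minimizer over $y\in H$ of $g(y)+\frac12\|x-y\|^2$. A weak sequential cluster point of a sequence in $H$ is the weak limit of some subsequence. *)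

theory Defs
  imports "HOL-Analysis.Analysis"
begin

text \<open>Real Hilbert spaces are rendered as types of sort \<open>{real_inner, complete_space}\<close>.\<close>

definition Fix :: "('a \<Rightarrow> 'a) \<Rightarrow> 'a set"
  where "Fix T = {x. T x = x}"

definition firmly_nonexpansive :: "('a::real_inner \<Rightarrow> 'a) \<Rightarrow> bool"
  where "firmly_nonexpansive T \<longleftrightarrow>
    (\<forall>x y. (norm (T x - T y))\<^sup>2 + (norm ((x - T x) - (y - T y)))\<^sup>2 \<le> (norm (x - y))\<^sup>2)"

text \<open>
  The proximity operator, restricted to real-valued (everywhere finite) functions. The description
  is meaningful when a unique minimizer exists, which holds on a real Hilbert space when \<open>g\<close> is
  convex and lower semicontinuous.
\<close>
definition Prox :: "('a::real_inner \<Rightarrow> real) \<Rightarrow> 'a \<Rightarrow> 'a"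
  where "Prox g x =
    (THE y. \<forall>z. g y + 1 / 2 * (norm (x - y))\<^sup>2 \<le> g z + 1 / 2 * (norm (x - z))\<^sup>2)"

text \<open>
  Weak convergence, tested against vectors; by the Riesz representation theorem these are all the
  continuous linear functionals on a Hilbert space.
\<close>
definition weakly_converges :: "(nat \<Rightarrow> 'a::real_inner) \<Rightarrow> 'a \<Rightarrow> bool"
  where "weakly_converges s p \<longleftrightarrow> (\<forall>u. (\<lambda>n. inner (s n) u) \<longlonglongrightarrow> inner p u)"

definition weak_seq_cluster_point :: "(nat \<Rightarrow> 'a::real_inner) \<Rightarrow> 'a \<Rightarrow> bool"
  where "weak_seq_cluster_point s p \<longleftrightarrow>
    (\<exists>r :: nat \<Rightarrow> nat. strict_mono r \<and> weakly_converges (s \<circ> r) p)"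

definition minimizers_on :: "('a \<Rightarrow> real) \<Rightarrow> 'a set \<Rightarrow> 'a set"
  where "minimizers_on g X = {x \<in> X. \<forall>z\<in>X. g x \<le> g z}"

end

theory Submission
  imports Defs
begin

text \<open>
  The scaled displacement \<open>\<parallel>x\<^sub>n\<^sub>+\<^sub>1 - x\<^sub>n\<parallel> / \<gamma>\<^sub>n\<close> satisfies a recursion
  \<open>s\<^sub>n\<^sub>+\<^sub>1 \<le> (1 - \<alpha>\<^sub>n\<^sub>+\<^sub>1) s\<^sub>n + \<alpha>\<^sub>n\<^sub>+\<^sub>1 e\<^sub>n\<close> with \<open>e\<^sub>n \<longlonglongrightarrow> 0\<close>, so it tends to \<open>0\<close> because \<open>\<Sum>\<alpha>\<^sub>n\<close>
  diverges. Summing over one cycle the descent inequality of the single steps bounds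
  \<open>\<Sum>\<^sub>i (\<parallel>x\<^sub>n\<^sup>i\<^sup>-\<^sup>1 - y\<^sub>n\<^sup>i\<parallel>\<^sup>2 + \<parallel>y\<^sub>n\<^sup>i - T\<^sup>i y\<^sub>n\<^sup>i\<parallel>\<^sup>2) + 2 \<gamma>\<^sub>n \<Sum>\<^sub>i (f\<^sup>i y\<^sub>n\<^sup>i - f\<^sup>i z)\<close> by \<open>o(\<gamma>\<^sub>n)\<close> for \<open>z\<close> in \<open>X\<close>.
  As each \<open>f\<^sup>i\<close> is bounded below on bounded sets, the gaps vanish; hence all the sequences have the
  same weak cluster points, which are fixed points by demiclosedness. Dividing by \<open>\<gamma>\<^sub>n\<close> and using
  weak lower semicontinuity yields optimality.
\<close>

section \<open>Firmly nonexpansive maps\<close>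

text \<open>The definition compares \<open>|p|^2 + |q|^2\<close> with \<open>|p + q|^2\<close> for
  \<open>p = T u - T v\<close> and \<open>q\<close> the difference of the displacements, so
  expanding the right side leaves only the cross term.\<close>

lemma firmly_nonexpansive_inner:
  assumes "firmly_nonexpansive T"
  shows "0 \<le> inner (T u - T v) ((u - T u) - (v - T v))"
proof -
  have "(norm (T u - T v))\<^sup>2 + (norm ((u - T u) - (v - T v)))\<^sup>2
      \<le> (norm ((T u - T v) + ((u - T u) - (v - T v))))\<^sup>2"
    using assms by (simp add: firmly_nonexpansive_def)
  then show ?thesis
    unfolding dot_norm by simp
qed

lemma firmly_nonexpansive_norm_le:
  assumes "firmly_nonexpansive T"
  shows "norm (T u - T v) \<le> norm (u - v)"
proof -
  have "(norm (T u - T v))\<^sup>2 + (norm ((u - T u) - (v - T v)))\<^sup>2 \<le> (norm (u - v))\<^sup>2"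
    using assms by (simp add: firmly_nonexpansive_def)
  then have "(norm (T u - T v))\<^sup>2 \<le> (norm (u - v))\<^sup>2"
    by (smt (verit) zero_le_power2)
  then show ?thesis
    by (rule power2_le_imp_le) simp
qed

text \<open>The cross term inequality at \<open>y n\<close> and \<open>p\<close> reads
  \<open>0 <= <y n - p, e n - d> - |e n - d|^2\<close>. Boundedness of \<open>y\<close> against the
  strong limit of \<open>e\<close>, and weak convergence against the fixed vector \<open>d\<close>,
  make the inner product vanish, so the limit is \<open>0 <= - |d|^2\<close>. This is the
  demiclosedness principle.\<close>

lemma firmly_nonexpansive_demiclosed:
  fixes T :: "'a::real_inner \<Rightarrow> 'a"
  assumes T: "firmly_nonexpansive T"
    and weak: "weakly_converges y p"
    and bdd: "bounded (range y)"
    and lim: "(\<lambda>n. y n - T (y n)) \<longlonglongrightarrow> 0"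
  shows "p \<in> Fix T"
proof -
  define e where "e n = y n - T (y n)" for n
  define d where "d = p - T p"
  have e: "e \<longlonglongrightarrow> 0"
    using lim unfolding e_def .
  obtain B where B: "\<And>n. norm (y n - p) \<le> B"
    using bdd by (metis bounded_any_center dist_norm norm_minus_commute rangeI)
  have "(\<lambda>n. B * norm (e n)) \<longlonglongrightarrow> 0"
    using tendsto_mult_right_zero[OF tendsto_norm_zero[OF e]] .
  then have ye: "(\<lambda>n. inner (y n - p) (e n)) \<longlonglongrightarrow> 0"
  proof (rule Lim_null_comparison[rotated])
    show "\<forall>\<^sub>F n in sequentially. norm (inner (y n - p) (e n)) \<le> B * norm (e n)"
      using B by (intro always_eventually allI)
        (metis Cauchy_Schwarz_ineq2 mult_right_mono norm_ge_zero order_trans real_norm_def)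
  qed
  have "(\<lambda>n. inner (y n) d - inner p d) \<longlonglongrightarrow> 0"
    using weak unfolding weakly_converges_def by (intro LIM_zero) blast
  then have yd: "(\<lambda>n. inner (y n - p) d) \<longlonglongrightarrow> 0"
    by (simp add: inner_diff_left)
  have "(\<lambda>n. inner (y n - p) (e n) - inner (y n - p) d - inner (e n - d) (e n - d))
      \<longlonglongrightarrow> 0 - 0 - inner (0 - d) (0 - d)"
    by (intro tendsto_intros ye yd e)
  moreover have "0 \<le> inner (y n - p) (e n) - inner (y n - p) d - inner (e n - d) (e n - d)" for n
  proof -
    have "T (y n) - T p = (y n - p) - (e n - d)"
      by (simp add: e_def d_def)
    then show ?thesis
      using firmly_nonexpansive_inner[OF T, of "y n" p]
      by (simp add: e_def[symmetric] d_def[symmetric] inner_diff_left inner_diff_right)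
  qed
  ultimately have "0 \<le> - inner d d"
    by (intro LIMSEQ_le_const[where a = 0]) auto
  then have "inner d d = 0"
    using inner_ge_zero[of d] by linarith
  then have "d = 0"
    by simp
  then show ?thesis
    by (simp add: d_def Fix_def)
qed

section \<open>Lower bounds for continuous convex functions\<close>

text \<open>Continuity bounds \<open>f\<close> by \<open>f v + 1\<close> on a ball of radius \<open>r\<close> around \<open>v\<close>; convexity on the
  segment from \<open>y\<close> through \<open>v\<close> to the boundary of that ball turns this upper bound into a
  lower bound at \<open>y\<close>.\<close>
lemma convex_on_continuous_cone_minorant:
  fixes f :: "'a::real_inner \<Rightarrow> real"
  assumes conv: "convex_on UNIV f" and cont: "continuous_on UNIV f"
  obtains C where "C \<ge> 0" "\<And>y. f v - C * norm (y - v) \<le> f y"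
proof -
  have "isCont f v"
    using cont by (simp add: continuous_on_eq_continuous_at)
  then obtain s where s: "s > 0" "\<And>w. dist w v < s \<Longrightarrow> dist (f w) (f v) < 1"
    unfolding continuous_at_eps_delta by (meson zero_less_one)
  \<comment> \<open>Halving keeps a point at distance exactly \<open>r\<close> from \<open>v\<close>
    strictly inside the ball of radius \<open>s\<close>.\<close>
  define r where "r = s / 2"
  have r: "r > 0" "r < s"
    using s(1) by (auto simp: r_def)
  have "f v - 1 / r * norm (y - v) \<le> f y" for y
  proof (cases "y = v")
    case False
    define d where "d = norm (y - v)"
    have d: "d > 0"
      using False by (simp add: d_def)
    define w where "w = v - (r / d) *\<^sub>R (y - v)"
    have "dist w v = r"
      using d r by (simp add: w_def dist_norm d_def)
    then have fw: "f w \<le> f v + 1"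
      using s(2)[of w] r by (simp add: dist_real_def)
    have sum1: "d / (r + d) + r / (r + d) = 1"
      using d r by (simp add: add_divide_distrib[symmetric])
    have "(d / (r + d)) *\<^sub>R w + (r / (r + d)) *\<^sub>R y
        = (d / (r + d)) *\<^sub>R v + (r / (r + d)) *\<^sub>R v"
      using d by (simp add: w_def algebra_simps)
    then have "(d / (r + d)) *\<^sub>R w + (r / (r + d)) *\<^sub>R y = v"
      using sum1 by (metis scaleR_add_left scaleR_one)
    then have "f v \<le> d / (r + d) * f w + r / (r + d) * f y"
      using conv d r sum1
      unfolding convex_on_def by (metis UNIV_I divide_nonneg_pos add_pos_pos less_imp_le)
    then have "f v \<le> (d * f w + r * f y) / (r + d)"
      by (simp add: add_divide_distrib)
    then have "(r + d) * f v \<le> d * f w + r * f y"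
      using d r by (simp add: pos_le_divide_eq mult.commute)
    moreover have "d * f w \<le> d * (f v + 1)"
      using fw d by simp
    ultimately have "r * f v \<le> d + r * f y"
      by (simp add: algebra_simps)
    then have "f v \<le> d / r + f y"
      using r by (simp add: field_simps)
    then show ?thesis
      by (simp add: d_def)
  qed simp
  with r show ?thesis
    by (intro that[of "1 / r"]) auto
qed

lemma convex_on_continuous_bounded_below:
  fixes f :: "'a::real_inner \<Rightarrow> real"
  assumes "convex_on UNIV f" "continuous_on UNIV f" "bounded S"
  obtains m where "\<And>y. y \<in> S \<Longrightarrow> m \<le> f y"
proof -
  obtain C where C: "C \<ge> 0" "\<And>y. f 0 - C * norm (y - 0) \<le> f y"
    using convex_on_continuous_cone_minorant[OF assms(1,2)] by blast
  obtain B where B: "\<And>y. y \<in> S \<Longrightarrow> norm y \<le> B"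
    using assms(3) by (auto simp: bounded_iff)
  have "f 0 - C * B \<le> f y" if "y \<in> S" for y
    using C(2)[of y] mult_left_mono[OF B[OF that] C(1)] by simp
  then show ?thesis
    by (rule that)
qed

section \<open>The proximity operator\<close>

text \<open>The cone minorant makes the infimum finite, strong convexity makes a minimizing sequence
  Cauchy, and by completeness and continuity its limit attains the infimum.\<close>

lemma prox_objective_has_minimizer:
  fixes g :: "'a::{real_inner, complete_space} \<Rightarrow> real"
  assumes conv: "convex_on UNIV g" and cont: "continuous_on UNIV g"
  obtains y where "\<And>z. g y + 1 / 2 * (norm (v - y))\<^sup>2 \<le> g z + 1 / 2 * (norm (v - z))\<^sup>2"
proof -
  define \<phi> where "\<phi> z = g z + 1 / 2 * (norm (v - z))\<^sup>2" for z
  obtain C where C: "C \<ge> 0" "\<And>y. g v - C * norm (y - v) \<le> g y"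
    using convex_on_continuous_cone_minorant[OF conv cont] by blast
  \<comment> \<open>Completing the square: with \<open>t = |v - z|\<close>, the loss
    \<open>C * t\<close> in the minorant is at most \<open>t^2 / 2 + C^2 / 2\<close>.\<close>
  have lb: "g v - C\<^sup>2 / 2 \<le> \<phi> z" for z
  proof -
    have "0 \<le> (norm (v - z) - C)\<^sup>2"
      by simp
    then show ?thesis
      using C(2)[of z] by (simp add: \<phi>_def power2_diff norm_minus_commute field_simps)
  qed
  define m where "m = Inf (range \<phi>)"
  have bdd: "bdd_below (range \<phi>)"
    using lb by (auto simp: bdd_below_def)
  have m_le: "m \<le> \<phi> z" for z
    unfolding m_def by (rule cInf_lower[OF _ bdd]) simp
  have "\<exists>z. \<phi> z < m + 1 / real (Suc n)" for n
  proof -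
    have "\<exists>t\<in>range \<phi>. t < m + 1 / real (Suc n)"
      unfolding m_def by (rule cInf_lessD) auto
    then show ?thesis
      by blast
  qed
  then obtain s where s: "\<And>n. \<phi> (s n) < m + 1 / real (Suc n)"
    by metis
  \<comment> \<open>By the parallelogram identity the objective at the midpoint lies at least
    \<open>|u - w|^2 / 8\<close> below the mean of its values at \<open>u\<close> and
    \<open>w\<close>, yet it is no smaller than \<open>m\<close>.\<close>
  have mid: "(norm (u - w))\<^sup>2 \<le> 4 * (\<phi> u + \<phi> w - 2 * m)" for u w
  proof -
    have "g ((1 / 2) *\<^sub>R u + (1 / 2) *\<^sub>R w) \<le> 1 / 2 * g u + 1 / 2 * g w"
      using convex_onD[OF conv, of "1 / 2" u w] by simp
    moreover have "(norm (v - ((1 / 2) *\<^sub>R u + (1 / 2) *\<^sub>R w)))\<^sup>2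
        = (norm (v - u))\<^sup>2 / 2 + (norm (v - w))\<^sup>2 / 2 - (norm (u - w))\<^sup>2 / 4"
      by (simp add: power2_norm_eq_inner inner_diff_left inner_diff_right inner_add_left
          inner_add_right inner_commute field_simps)
    ultimately show ?thesis
      using m_le[of "(1 / 2) *\<^sub>R u + (1 / 2) *\<^sub>R w"] by (simp add: \<phi>_def field_simps)
  qed
  have "Cauchy s"
  proof (rule metric_CauchyI)
    fix e :: real
    assume e: "0 < e"
    \<comment> \<open>Two excesses over \<open>m\<close>, each below \<open>e^2 / 8\<close>, give
      \<open>e^2\<close> after the factor 4 in \<open>mid\<close>.\<close>
    then obtain N where N: "1 / real (Suc N) < e\<^sup>2 / 8"
      using nat_approx_posE[of "e\<^sup>2 / 8"] by (auto simp: zero_less_power)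
    have "dist (s k) (s n) < e" if "k \<ge> N" "n \<ge> N" for k n
    proof -
      have "1 / real (Suc k) \<le> 1 / real (Suc N)" "1 / real (Suc n) \<le> 1 / real (Suc N)"
        using that by (auto intro!: divide_left_mono)
      then have "\<phi> (s k) < m + e\<^sup>2 / 8" "\<phi> (s n) < m + e\<^sup>2 / 8"
        using s[of k] s[of n] N by auto
      then have "(norm (s k - s n))\<^sup>2 < e\<^sup>2"
        using mid[of "s k" "s n"] by (simp add: field_simps)
      then show ?thesis
        using e by (simp add: dist_norm power2_less_imp_less)
    qed
    then show "\<exists>M. \<forall>k\<ge>M. \<forall>n\<ge>M. dist (s k) (s n) < e"
      by blast
  qed
  then obtain y where y: "s \<longlonglongrightarrow> y"
    using Cauchy_convergent convergent_def by blast
  have "continuous_on UNIV \<phi>"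
    unfolding \<phi>_def by (intro continuous_intros cont)
  then have "(\<lambda>n. \<phi> (s n)) \<longlonglongrightarrow> \<phi> y"
    using y by (simp add: continuous_on_eq_continuous_at isCont_tendsto_compose)
  moreover have "(\<lambda>n. m + 1 / real (Suc n)) \<longlonglongrightarrow> m + 0"
    by (intro tendsto_intros LIMSEQ_Suc[OF lim_const_over_n])
  ultimately have "\<phi> y \<le> m"
    using s by (intro LIMSEQ_le[where X = "\<lambda>n. \<phi> (s n)"]) (auto intro: less_imp_le)
  then have "\<phi> y \<le> \<phi> z" for z
    using m_le[of z] by simp
  then show ?thesis
    by (intro that[of y]) (simp add: \<phi>_def)
qed

text \<open>Minimality is tested at the points \<open>(1 - t) y + t z\<close> of the segment: after
  convexity and division by \<open>t\<close>, the quadratic remainder vanishes as \<open>t\<close>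
  decreases to 0.\<close>

lemma prox_minimizer_variational:
  fixes g :: "'a::real_inner \<Rightarrow> real"
  assumes conv: "convex_on UNIV g"
    and min: "\<And>z. g y + 1 / 2 * (norm (v - y))\<^sup>2 \<le> g z + 1 / 2 * (norm (v - z))\<^sup>2"
  shows "g y - g z \<le> inner (v - y) (y - z)"
proof -
  have "g y - g z \<le> inner (v - y) (y - z) + t / 2 * (norm (y - z))\<^sup>2"
    if t: "0 < t" "t < 1" for t
  proof -
    define w where "w = (1 - t) *\<^sub>R y + t *\<^sub>R z"
    have "g w \<le> (1 - t) * g y + t * g z"
      using conv t unfolding convex_on_def w_def by auto
    moreover have "(norm (v - w))\<^sup>2
        = (norm (v - y))\<^sup>2 + 2 * t * inner (v - y) (y - z) + t\<^sup>2 * (norm (y - z))\<^sup>2"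
    proof -
      have "v - w = (v - y) + t *\<^sub>R (y - z)"
        by (simp add: w_def algebra_simps)
      then show ?thesis
        by (simp only: power2_norm_eq_inner inner_add_left inner_add_right inner_scaleR_left
            inner_scaleR_right) (simp add: inner_commute power2_eq_square algebra_simps)
    qed
    ultimately have "t * (g y - g z) \<le> t * (inner (v - y) (y - z) + t / 2 * (norm (y - z))\<^sup>2)"
      using min[of w] by (simp add: power2_eq_square algebra_simps)
    then show ?thesis
      using t by simp
  qed
  then have "\<forall>\<^sub>F t in at_right 0. g y - g z \<le> inner (v - y) (y - z) + t / 2 * (norm (y - z))\<^sup>2"
    by (auto simp: eventually_at_right_field intro!: exI[of _ 1])
  moreover have "((\<lambda>t. inner (v - y) (y - z) + t / 2 * (norm (y - z))\<^sup>2)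
      \<longlongrightarrow> inner (v - y) (y - z) + 0 / 2 * (norm (y - z))\<^sup>2) (at_right 0)"
    by (intro tendsto_intros) simp
  ultimately show ?thesis
    using tendsto_lowerbound[of _ _ "at_right (0::real)"] by simp
qed

text \<open>The description in \<open>Prox\<close> needs uniqueness besides existence: adding the
  inequalities of two minimizers, each tested at the other, cancels \<open>g\<close> and leaves
  \<open>|y - y'|^2 <= 0\<close>.\<close>

lemma Prox_variational:
  fixes g :: "'a::{real_inner, complete_space} \<Rightarrow> real"
  assumes conv: "convex_on UNIV g" and cont: "continuous_on UNIV g"
  shows "g (Prox g v) - g z \<le> inner (v - Prox g v) (Prox g v - z)"
proof -
  define M where "M y \<longleftrightarrow> (\<forall>z. g y + 1 / 2 * (norm (v - y))\<^sup>2 \<le> g z + 1 / 2 * (norm (v - z))\<^sup>2)"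
    for y
  obtain y where y: "M y"
    using prox_objective_has_minimizer[OF conv cont] unfolding M_def by blast
  have "y' = y" if "M y'" for y'
  proof -
    have "g y - g y' \<le> inner (v - y) (y - y')" "g y' - g y \<le> inner (v - y') (y' - y)"
      using y that prox_minimizer_variational[OF conv] unfolding M_def by blast+
    then have "inner (y - y') (y - y') \<le> 0"
      by (simp add: inner_diff_left inner_diff_right inner_commute)
    then show ?thesis
      by (metis eq_iff_diff_eq_0 inner_ge_zero inner_eq_zero_iff order_antisym)
  qed
  then have "M (Prox g v)"
    using y unfolding Prox_def M_def[symmetric] by (metis theI)
  then show ?thesis
    unfolding M_def by (intro prox_minimizer_variational[OF conv]) blast
qed

lemma Prox_scaled_variational:
  fixes f :: "'a::{real_inner, complete_space} \<Rightarrow> real"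
  assumes "convex_on UNIV f" "continuous_on UNIV f" "c > 0"
  shows "c * (f (Prox (\<lambda>z. c * f z) v) - f w)
    \<le> inner (v - Prox (\<lambda>z. c * f z) v) (Prox (\<lambda>z. c * f z) v - w)"
proof -
  have "convex_on UNIV (\<lambda>z. c * f z)"
    using assms by (intro convex_on_cmul) auto
  moreover have "continuous_on UNIV (\<lambda>z. c * f z)"
    by (intro continuous_intros assms)
  ultimately show ?thesis
    using Prox_variational[of "\<lambda>z. c * f z"] by (simp add: right_diff_distrib)
qed

text \<open>Scaling the second variational inequality by \<open>c / c'\<close> makes the function
  values cancel in the sum; Cauchy-Schwarz does the rest. For \<open>c = c'\<close> this is
  nonexpansiveness of the proximity operator.\<close>

lemma Prox_perturbation:
  fixes f :: "'a::{real_inner, complete_space} \<Rightarrow> real"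
  assumes f: "convex_on UNIV f" "continuous_on UNIV f" and c: "c > 0" "c' > 0"
    and y: "y = Prox (\<lambda>z. c * f z) v" and y': "y' = Prox (\<lambda>z. c' * f z) v'"
  shows "norm (y - y') \<le> norm (v - v') + \<bar>1 - c / c'\<bar> * norm (v' - y')"
proof -
  have "c * (f y - f y') \<le> inner (v - y) (y - y')"
    using Prox_scaled_variational[OF f c(1)] y by blast
  moreover have "c' * (f y' - f y) \<le> inner (v' - y') (y' - y)"
    using Prox_scaled_variational[OF f c(2)] y' by blast
  then have "c / c' * (c' * (f y' - f y)) \<le> c / c' * inner (v' - y') (y' - y)"
    using c by (intro mult_left_mono) auto
  then have "c * (f y' - f y) \<le> c / c' * inner (v' - y') (y' - y)"
    using c by simp
  ultimately have "0 \<le> inner (v - y) (y - y') + c / c' * inner (v' - y') (y' - y)"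
    by (simp add: algebra_simps)
  then have "inner (y - y') (y - y')
      \<le> inner ((v - v') + (1 - c / c') *\<^sub>R (v' - y')) (y - y')"
    by (simp add: inner_diff_left inner_diff_right inner_add_left algebra_simps)
  also have "\<dots> \<le> norm ((v - v') + (1 - c / c') *\<^sub>R (v' - y')) * norm (y - y')"
    by (rule norm_cauchy_schwarz)
  finally have "norm (y - y') * norm (y - y')
      \<le> norm ((v - v') + (1 - c / c') *\<^sub>R (v' - y')) * norm (y - y')"
    by (simp add: power2_norm_eq_inner[symmetric] power2_eq_square)
  then have "norm (y - y') \<le> norm ((v - v') + (1 - c / c') *\<^sub>R (v' - y'))"
    by (cases "y = y'") auto
  also have "\<dots> \<le> norm (v - v') + \<bar>1 - c / c'\<bar> * norm (v' - y')"
    by (metis norm_scaleR norm_triangle_ineq)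
  finally show ?thesis .
qed

section \<open>Weak lower semicontinuity of continuous convex functions\<close>

text \<open>The affine minorant of \<open>f\<close> at \<open>Prox (\<lambda>z. c * f z) p\<close> supplied by the variational inequality
  replaces a subgradient at \<open>p\<close>; its value at \<open>p\<close> tends to \<open>f p\<close> as \<open>c\<close> tends to \<open>0\<close>.\<close>
lemma convex_on_continuous_weakly_lsc:
  fixes f :: "'a::{real_inner, complete_space} \<Rightarrow> real"
  assumes f: "convex_on UNIV f" "continuous_on UNIV f"
    and weak: "weakly_converges y p" and e: "e > 0"
  shows "\<forall>\<^sub>F n in sequentially. f p - e < f (y n)"
proof -
  obtain C where C: "C \<ge> 0" "\<And>z. f p - C * norm (z - p) \<le> f z"
    using convex_on_continuous_cone_minorant[OF f] by blast
  \<comment> \<open>Chosen to give \<open>c * C^2 < e\<close>; the summand 1 keeps the denominator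
    positive when \<open>C = 0\<close>.\<close>
  define c where "c = e / (2 * (C\<^sup>2 + 1))"
  have c: "c > 0"
    using e by (simp add: c_def add_nonneg_pos)
  have cC: "c * C\<^sup>2 < e"
  proof -
    have pos: "0 < 2 * (C\<^sup>2 + 1)"
      by (simp add: add_nonneg_pos)
    have "C\<^sup>2 < 2 * (C\<^sup>2 + 1)"
      using zero_le_power2[of C] by (smt (verit))
    then have "e * C\<^sup>2 < e * (2 * (C\<^sup>2 + 1))"
      using e by simp
    then show ?thesis
      using pos by (simp add: c_def divide_less_eq)
  qed
  define q where "q = Prox (\<lambda>z. c * f z) p"
  have var: "c * (f q - f w) \<le> inner (p - q) (q - w)" for w
    using Prox_scaled_variational[OF f c] unfolding q_def by blast
  \<comment> \<open>The inequality at \<open>w = p\<close> bounds \<open>|p - q|^2\<close> by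
    \<open>c * (f p - f q)\<close>, and the cone minorant bounds this by
    \<open>c * C * |p - q|\<close>. Hence \<open>f q\<close> falls short of \<open>f p\<close> by at
    most \<open>c * C^2\<close>.\<close>
  have "norm (p - q) \<le> c * C"
  proof -
    have "norm (p - q) * norm (p - q) \<le> c * (f p - f q)"
      using var[of p] by (simp add: power2_eq_square[symmetric] power2_norm_eq_inner
          inner_diff_left inner_diff_right inner_commute algebra_simps)
    also have "\<dots> \<le> c * (C * norm (p - q))"
      using C(2)[of q] c by (simp add: norm_minus_commute)
    finally have "norm (p - q) * norm (p - q) \<le> (c * C) * norm (p - q)"
      by (simp add: mult.assoc)
    then show ?thesis
      using c C(1) by (cases "p = q") auto
  qed
  then have "C * norm (p - q) \<le> C * (c * C)"
    using C(1) by (rule mult_left_mono)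
  then have fq: "f p - e < f q"
    using C(2)[of q] cC by (simp add: norm_minus_commute power2_eq_square algebra_simps)
  have "(\<lambda>n. inner (y n) (p - q)) \<longlonglongrightarrow> inner p (p - q)"
    using weak unfolding weakly_converges_def by blast
  then have "(\<lambda>n. f q + (inner (y n) (p - q) - inner q (p - q)) / c)
      \<longlonglongrightarrow> f q + (inner p (p - q) - inner q (p - q)) / c"
    using c by (intro tendsto_add tendsto_divide tendsto_diff tendsto_const) auto
  moreover have "f p - e < f q + (inner p (p - q) - inner q (p - q)) / c"
  proof -
    have "0 \<le> inner p (p - q) - inner q (p - q)"
      by (metis inner_diff_left inner_ge_zero)
    then show ?thesis
      using fq c by (smt (verit) divide_nonneg_pos)
  qed
  ultimately have "\<forall>\<^sub>F n in sequentially.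
      f p - e < f q + (inner (y n) (p - q) - inner q (p - q)) / c"
    by (rule order_tendstoD)
  moreover have "f q + (inner w (p - q) - inner q (p - q)) / c \<le> f w" for w
    using var[of w] c
    by (simp add: inner_diff_left inner_diff_right inner_commute field_simps)
  ultimately show ?thesis
    by (auto elim!: eventually_mono intro: less_le_trans)
qed

section \<open>A scalar recursion, weak limits, and a single step of the iteration\<close>

text \<open>Once \<open>e n <= l / 2\<close>, the recursion passes to the excess
  \<open>s n - l / 2\<close> with factor \<open>1 - b n <= exp (- b n)\<close>. The product of these
  factors is the exponential of minus a divergent sum, so it tends to 0.\<close>

lemma averaged_recursion_tendsto_zero:
  fixes s b e :: "nat \<Rightarrow> real"
  assumes s: "\<And>n. 0 \<le> s n" and b: "\<And>n. 0 \<le> b n" "\<And>n. b n \<le> 1"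
    and div: "filterlim (\<lambda>N. \<Sum>n<N. b n) at_top sequentially"
    and e: "e \<longlonglongrightarrow> 0"
    and rec: "\<And>n. s (Suc n) \<le> (1 - b n) * s n + b n * e n"
  shows "s \<longlonglongrightarrow> 0"
proof (rule order_tendstoI)
  fix l :: real
  assume l: "0 < l"
  obtain N where N: "\<And>n. n \<ge> N \<Longrightarrow> e n \<le> l / 2"
    using order_tendstoD(2)[OF e, of "l / 2"] l
    unfolding eventually_sequentially by (meson half_gt_zero less_imp_le)
  define S where "S n = (\<Sum>k<n. b k)" for n
  \<comment> \<open>The right side carries \<open>s N\<close> instead of \<open>s N - l / 2\<close>
    so that it stays nonnegative, as required when \<open>1 - b\<close> is replaced by
    \<open>exp (- b)\<close>.\<close>
  have bound: "s (N + k) - l / 2 \<le> exp (S N - S (N + k)) * s N" for k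
  proof (induction k)
    case 0
    then show ?case
      using l by simp
  next
    case (Suc k)
    let ?n = "N + k"
    have "b ?n * e ?n \<le> b ?n * (l / 2)"
      using b N[of ?n] by (intro mult_left_mono) auto
    then have "s (Suc ?n) - l / 2 \<le> (1 - b ?n) * (s ?n - l / 2)"
      using rec[of ?n] by (simp add: algebra_simps)
    also have "\<dots> \<le> (1 - b ?n) * (exp (S N - S ?n) * s N)"
      using b(2)[of ?n] Suc by (intro mult_left_mono) auto
    also have "\<dots> \<le> exp (- b ?n) * (exp (S N - S ?n) * s N)"
      using s exp_ge_add_one_self[of "- b ?n"] by (intro mult_right_mono) auto
    also have "\<dots> = exp (S N - S (N + Suc k)) * s N"
      by (simp add: S_def mult_exp_exp algebra_simps flip: mult.assoc)
    finally show ?case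
      by simp
  qed
  have "filterlim (\<lambda>k. S (N + k)) at_top sequentially"
    using filterlim_compose[OF div filterlim_subseq[of "\<lambda>k. N + k"]]
    by (simp add: S_def strict_mono_def)
  then have "filterlim (\<lambda>k. - S N + S (N + k)) at_top sequentially"
    by (rule filterlim_tendsto_add_at_top[OF tendsto_const])
  then have "filterlim (\<lambda>k. S N - S (N + k)) at_bot sequentially"
    by (subst filterlim_uminus_at_bot) (simp add: algebra_simps)
  then have "(\<lambda>k. exp (S N - S (N + k)) * s N) \<longlonglongrightarrow> 0"
    by (intro tendsto_mult_left_zero filterlim_compose[OF exp_at_bot])
  then have "\<forall>\<^sub>F k in sequentially. exp (S N - S (N + k)) * s N < l / 2"
    using l by (intro order_tendstoD) auto
  then have "\<forall>\<^sub>F k in sequentially. s (k + N) < l"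
    by (rule eventually_mono) (use bound in \<open>smt (verit) add.commute field_sum_of_halves\<close>)
  then show "\<forall>\<^sub>F n in sequentially. s n < l"
    using eventually_sequentially_seg by blast
qed (use s in \<open>auto intro: always_eventually less_le_trans\<close>)

lemma weakly_converges_perturb:
  assumes "weakly_converges s p" "(\<lambda>n. t n - s n) \<longlonglongrightarrow> 0"
  shows "weakly_converges t p"
  unfolding weakly_converges_def
proof
  fix u
  have "(\<lambda>n. inner (s n) u + inner (t n - s n) u) \<longlonglongrightarrow> inner p u + inner 0 u"
    using assms(1) unfolding weakly_converges_def
    by (intro tendsto_add tendsto_inner[OF assms(2) tendsto_const]) blast
  then show "(\<lambda>n. inner (t n) u) \<longlonglongrightarrow> inner p u"
    by (simp add: inner_diff_left)
qed

text \<open>In the expansion of \<open>|v - z|^2\<close> around \<open>y\<close> the prox inequality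
  bounds the cross term; firm nonexpansiveness at the fixed point \<open>z\<close> contributes
  \<open>|y - T y|^2\<close>; convexity of the square absorbs the anchor \<open>a\<close>, with the
  weight \<open>1 - t\<close> of \<open>|T y - z|^2\<close> relaxed to 1.\<close>

lemma halpern_prox_step:
  fixes f :: "'a::{real_inner, complete_space} \<Rightarrow> real"
  assumes T: "firmly_nonexpansive T" and z: "z \<in> Fix T"
    and f: "convex_on UNIV f" "continuous_on UNIV f"
    and c: "c > 0" and t: "0 \<le> t" "t \<le> 1"
    and y: "y = Prox (\<lambda>z. c * f z) v" and v': "v' = t *\<^sub>R a + (1 - t) *\<^sub>R T y"
  shows "(norm (v' - z))\<^sup>2 + ((norm (v - y))\<^sup>2 + (norm (y - T y))\<^sup>2)
    \<le> (norm (v - z))\<^sup>2 + 2 * c * (f z - f y) + t * (norm (a - z))\<^sup>2"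
proof -
  have "c * (f y - f z) \<le> inner (v - y) (y - z)"
    using Prox_scaled_variational[OF f c] y by blast
  moreover have "(norm (v - z))\<^sup>2 = (norm (v - y))\<^sup>2 + 2 * inner (v - y) (y - z) + (norm (y - z))\<^sup>2"
    by (simp add: power2_norm_eq_inner inner_diff_left inner_diff_right inner_commute)
  moreover have "(norm (T y - z))\<^sup>2 + (norm (y - T y))\<^sup>2 \<le> (norm (y - z))\<^sup>2"
    using T z unfolding firmly_nonexpansive_def Fix_def
    by (metis (mono_tags) diff_self diff_zero mem_Collect_eq)
  moreover have "(norm (v' - z))\<^sup>2 \<le> t * (norm (a - z))\<^sup>2 + (norm (T y - z))\<^sup>2"
  proof -
    have "v' - z = t *\<^sub>R (a - z) + (1 - t) *\<^sub>R (T y - z)"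
      by (simp add: v' algebra_simps)
    then have "norm (v' - z) \<le> t * norm (a - z) + (1 - t) * norm (T y - z)"
      using t norm_triangle_ineq[of "t *\<^sub>R (a - z)" "(1 - t) *\<^sub>R (T y - z)"] by simp
    then have "(norm (v' - z))\<^sup>2 \<le> (t * norm (a - z) + (1 - t) * norm (T y - z))\<^sup>2"
      by (rule power_mono) simp
    also have "\<dots> \<le> t * (norm (a - z))\<^sup>2 + (1 - t) * (norm (T y - z))\<^sup>2"
      using t convex_onD[OF convex_power2, of t "norm (T y - z)" "norm (a - z)"]
      by (simp add: algebra_simps)
    also have "\<dots> \<le> t * (norm (a - z))\<^sup>2 + (norm (T y - z))\<^sup>2"
      using t by (simp add: mult_left_le_one_le)
    finally show ?thesis .
  qed
  ultimately show ?thesis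
    by (simp add: algebra_simps)
qed

theorem theorem3p1:
  fixes I :: nat
    and T :: "nat \<Rightarrow> 'a::{real_inner, complete_space} \<Rightarrow> 'a"
    and f :: "nat \<Rightarrow> 'a \<Rightarrow> real"
    and X :: "'a set"
    and \<alpha> \<gamma> :: "nat \<Rightarrow> real"
    and a :: "nat \<Rightarrow> 'a"
    and x0 :: 'a
    and x :: "nat \<Rightarrow> 'a"
    and xi yi :: "nat \<Rightarrow> nat \<Rightarrow> 'a"
  assumes I: "I \<ge> 1"
    and T: "\<And>i. i \<in> {1..I} \<Longrightarrow> firmly_nonexpansive (T i)"
    and X: "X = (\<Inter>i\<in>{1..I}. Fix (T i))"
    and X_nonempty: "X \<noteq> {}"
    and f_continuous: "\<And>i. i \<in> {1..I} \<Longrightarrow> continuous_on UNIV (f i)"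
    and f_convex: "\<And>i. i \<in> {1..I} \<Longrightarrow> convex_on UNIV (f i)"
    and \<alpha>_range: "\<And>n. \<alpha> n \<in> {0<..1}"
    and \<gamma>_range: "\<And>n. \<gamma> n \<in> {0<..}"
    and \<alpha>_lim: "\<alpha> \<longlonglongrightarrow> 0"
    and \<gamma>_lim: "\<gamma> \<longlonglongrightarrow> 0"
    and \<alpha>_sum: "filterlim (\<lambda>N. \<Sum>n\<le>N. \<alpha> n) at_top sequentially"
    and C2: "(\<lambda>n. 1 / \<alpha> (n + 1) * \<bar>1 / \<gamma> (n + 1) - 1 / \<gamma> n\<bar>) \<longlonglongrightarrow> 0"
    and C3: "(\<lambda>n. 1 / \<gamma> (n + 1) * \<bar>1 - \<alpha> n / \<alpha> (n + 1)\<bar>) \<longlonglongrightarrow> 0"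
    and C4: "(\<lambda>n. 1 / \<alpha> (n + 1) * (\<bar>\<gamma> (n + 1) - \<gamma> n\<bar> / (\<gamma> (n + 1))\<^sup>2)) \<longlonglongrightarrow> 0"
    and C5: "(\<lambda>n. \<alpha> n / \<gamma> n) \<longlonglongrightarrow> 0"
    and x_0: "x 0 = x0"
    and xi_0: "\<And>n. xi n 0 = x n"
    and yi: "\<And>n i. i \<in> {1..I} \<Longrightarrow> yi n i = Prox (\<lambda>z. \<gamma> n * f i z) (xi n (i - 1))"
    and xi: "\<And>n i. i \<in> {1..I} \<Longrightarrow> xi n i = \<alpha> n *\<^sub>R a i + (1 - \<alpha> n) *\<^sub>R T i (yi n i)"
    and x_Suc: "\<And>n. x (n + 1) = xi n I"
    and yi_bounded: "\<And>i. i \<in> {1..I} \<Longrightarrow> bounded (range (\<lambda>n. yi n i))"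
  shows "\<forall>i\<in>{1..I}. \<forall>p. weak_seq_cluster_point (\<lambda>n. xi n i) p \<longrightarrow>
           p \<in> minimizers_on (\<lambda>z. \<Sum>j\<in>{1..I}. f j z) X"
proof -
  have \<alpha>: "0 < \<alpha> n" "\<alpha> n \<le> 1" and \<gamma>: "0 < \<gamma> n" for n
    using \<alpha>_range[of n] \<gamma>_range[of n] by auto
  have x_Suc': "x (Suc n) = xi n I" for n
    using x_Suc[of n] by simp
  define F where "F z = (\<Sum>j\<in>{1..I}. f j z)" for z
  define G where "G n = (\<Sum>j\<in>{1..I}. f j (yi n j))" for n
  define gap where "gap n = (\<Sum>j\<in>{1..I}. (norm (xi n (j - 1) - yi n j))\<^sup>2
      + (norm (yi n j - T j (yi n j)))\<^sup>2)" for n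
  have gap_nonneg: "0 \<le> gap n" for n
    unfolding gap_def by (intro sum_nonneg) simp
  obtain z0 where z0: "z0 \<in> X"
    using X_nonempty by blast
  have Fix_T: "z \<in> Fix (T j)" if "z \<in> X" "j \<in> {1..I}" for z j
    using that X by blast

  \<comment> \<open>Boundedness of all sequences\<close>
  have bounded_T: "bounded (range (\<lambda>n. T j (yi n j)))" if j: "j \<in> {1..I}" for j
  proof -
    obtain B where B: "\<And>n. norm (yi n j) \<le> B"
      using yi_bounded[OF j] by (auto simp: bounded_iff)
    have "norm (T j (yi n j)) \<le> B + 2 * norm z0" for n
    proof -
      have "T j z0 = z0"
        using Fix_T[OF z0 j] by (simp add: Fix_def)
      then have "norm (T j (yi n j) - z0) \<le> norm (yi n j - z0)"
        using firmly_nonexpansive_norm_le[OF T[OF j]] by metis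
      then show ?thesis
        using B[of n] norm_triangle_sub[of "T j (yi n j)" z0] norm_triangle_ineq4[of "yi n j" z0]
        by linarith
    qed
    then show ?thesis
      by (auto simp: bounded_iff)
  qed
  have bounded_xi: "bounded (range (\<lambda>n. xi n j))" if j: "j \<in> {1..I}" for j
  proof -
    obtain B where B: "\<And>n. norm (T j (yi n j)) \<le> B"
      using bounded_T[OF j] by (auto simp: bounded_iff)
    have "norm (xi n j) \<le> norm (a j) + B" for n
    proof -
      have "norm (xi n j) \<le> \<alpha> n * norm (a j) + (1 - \<alpha> n) * norm (T j (yi n j))"
        unfolding xi[OF j] using \<alpha>[of n] by (intro norm_triangle_le) simp
      also have "\<dots> \<le> 1 * norm (a j) + 1 * norm (T j (yi n j))"
        using \<alpha>[of n] by (intro add_mono mult_right_mono) auto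
      finally show ?thesis
        using B[of n] by simp
    qed
    then show ?thesis
      by (auto simp: bounded_iff)
  qed
  have "range x \<subseteq> insert (x 0) (range (\<lambda>n. xi n I))"
    using x_Suc' by (metis insertCI not0_implies_Suc rangeI image_subsetI)
  then have bounded_x: "bounded (range x)"
    using bounded_subset[of "insert (x 0) (range (\<lambda>n. xi n I))"] bounded_xi[of I] I
      bounded_insert by auto
  \<comment> \<open>A single radius \<open>K\<close> for all iterates and anchors, so that the
    difference of any two of them has norm at most \<open>2 * K\<close>.\<close>
  define S where "S = range x \<union> a ` {1..I} \<union> (\<Union>j\<in>{1..I}. range (\<lambda>n. yi n j)
      \<union> range (\<lambda>n. T j (yi n j)) \<union> range (\<lambda>n. xi n j))"
  have "bounded S"
    unfolding S_def using bounded_x bounded_T bounded_xi yi_bounded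
    by (intro bounded_Un[THEN iffD2] conjI bounded_UN ballI finite_imp_bounded[of "a ` {1..I}"])
      simp_all
  then obtain K where K: "\<And>s. s \<in> S \<Longrightarrow> norm s \<le> K"
    by (auto simp: bounded_iff)
  have K_a: "norm (a j) \<le> K" and K_y: "norm (yi n j) \<le> K" and K_T: "norm (T j (yi n j)) \<le> K"
    if "j \<in> {1..I}" for n j
    using that by (intro K[unfolded S_def]; blast)+
  have K_x: "norm (x n) \<le> K" for n
    by (intro K) (simp add: S_def)
  have K_xi: "norm (xi n (j - 1)) \<le> K" if "j \<in> {1..I}" for n j
  proof (cases "j = 1")
    case True
    then show ?thesis
      using K_x xi_0 by simp
  next
    case False
    then have "j - 1 \<in> {1..I}"
      using that by auto
    then show ?thesis
      by (intro K[unfolded S_def]) blast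
  qed
  have K0: "0 \<le> K"
    using K_x[of 0] norm_ge_zero order_trans by blast

  \<comment> \<open>The scaled displacement tends to zero\<close>
  \<comment> \<open>The parameter drift of one step: \<open>2 * K\<close> bounds
    \<open>|a j - T j (yi n j)|\<close>, which multiplies the change of \<alpha>, and
    \<open>|xi n (j - 1) - yi n j|\<close>, which multiplies the relative change of \<gamma> in
    \<open>Prox_perturbation\<close>.\<close>
  define \<eta> where "\<eta> n = 2 * K * (\<bar>\<alpha> (Suc n) - \<alpha> n\<bar> + \<bar>1 - \<gamma> (Suc n) / \<gamma> n\<bar>)" for n
  have \<eta>0: "0 \<le> \<eta> n" for n
    using K0 by (simp add: \<eta>_def)
  have one_step: "norm (xi (Suc n) j - xi n j)
      \<le> (1 - \<alpha> (Suc n)) * norm (xi (Suc n) (j - 1) - xi n (j - 1)) + \<eta> n"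
    if j: "j \<in> {1..I}" for n j
  proof -
    let ?d = "norm (xi (Suc n) (j - 1) - xi n (j - 1))"
    let ?g = "\<bar>1 - \<gamma> (Suc n) / \<gamma> n\<bar>"
    have "norm (yi (Suc n) j - yi n j) \<le> ?d + ?g * norm (xi n (j - 1) - yi n j)"
      by (rule Prox_perturbation[OF f_convex[OF j] f_continuous[OF j] \<gamma> \<gamma> yi[OF j] yi[OF j]])
    also have "norm (xi n (j - 1) - yi n j) \<le> 2 * K"
      using norm_triangle_ineq4[of "xi n (j - 1)" "yi n j"] K_xi[OF j, of n] K_y[OF j, of n]
      by linarith
    finally have y: "norm (yi (Suc n) j - yi n j) \<le> ?d + ?g * (2 * K)"
      by (simp add: mult_left_mono)
    have "xi (Suc n) j - xi n j = (\<alpha> (Suc n) - \<alpha> n) *\<^sub>R (a j - T j (yi n j))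
        + (1 - \<alpha> (Suc n)) *\<^sub>R (T j (yi (Suc n) j) - T j (yi n j))"
      unfolding xi[OF j] by (simp add: algebra_simps)
    then have "norm (xi (Suc n) j - xi n j) \<le> \<bar>\<alpha> (Suc n) - \<alpha> n\<bar> * norm (a j - T j (yi n j))
        + (1 - \<alpha> (Suc n)) * norm (T j (yi (Suc n) j) - T j (yi n j))"
      using \<alpha>[of "Suc n"] by (simp add: norm_triangle_le)
    also have "\<dots> \<le> \<bar>\<alpha> (Suc n) - \<alpha> n\<bar> * (2 * K)
        + (1 - \<alpha> (Suc n)) * (?d + ?g * (2 * K))"
    proof (intro add_mono mult_left_mono)
      show "norm (a j - T j (yi n j)) \<le> 2 * K"
        using norm_triangle_ineq4[of "a j" "T j (yi n j)"] K_a[OF j] K_T[OF j, of n] by linarith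
      show "norm (T j (yi (Suc n) j) - T j (yi n j)) \<le> ?d + ?g * (2 * K)"
        using firmly_nonexpansive_norm_le[OF T[OF j]] y order_trans by blast
    qed (use \<alpha>[of "Suc n"] in auto)
    also have "\<dots> \<le> \<bar>\<alpha> (Suc n) - \<alpha> n\<bar> * (2 * K) + ((1 - \<alpha> (Suc n)) * ?d + ?g * (2 * K))"
      using \<alpha>[of "Suc n"] K0 by (simp add: distrib_left mult_left_le_one_le)
    finally show ?thesis
      by (simp add: \<eta>_def algebra_simps)
  qed
  \<comment> \<open>Only the first step of the cycle keeps its contraction factor; the later factors
    are bounded by 1, so one \<eta> accumulates per step.\<close>
  have cycle: "norm (xi (Suc n) j - xi n j)
      \<le> (1 - \<alpha> (Suc n)) * norm (x (Suc n) - x n) + real j * \<eta> n"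
    if "1 \<le> j" "j \<le> I" for n j
    using that
  proof (induction j rule: dec_induct)
    case base
    then show ?case
      using one_step[of 1 n] by (simp add: xi_0)
  next
    case (step j)
    have "norm (xi (Suc n) (Suc j) - xi n (Suc j))
        \<le> (1 - \<alpha> (Suc n)) * norm (xi (Suc n) j - xi n j) + \<eta> n"
      using one_step[of "Suc j" n] step.prems by simp
    also have "\<dots> \<le> norm (xi (Suc n) j - xi n j) + \<eta> n"
      using \<alpha>[of "Suc n"] by (simp add: mult_left_le_one_le)
    finally show ?case
      using step.IH step.prems by (simp add: algebra_simps)
  qed

  define s where "s n = norm (x (Suc n) - x n) / \<gamma> n" for n
  have s: "s \<longlonglongrightarrow> 0"
  proof (rule averaged_recursion_tendsto_zero)
    define c2 where "c2 n = 1 / \<alpha> (n + 1) * \<bar>1 / \<gamma> (n + 1) - 1 / \<gamma> n\<bar>" for n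
    define c3 where "c3 n = 1 / \<gamma> (n + 1) * \<bar>1 - \<alpha> n / \<alpha> (n + 1)\<bar>" for n
    \<comment> \<open>The first summand pays for replacing the divisor \<open>\<gamma> n\<close> of
      the displacement by \<open>\<gamma> (Suc n)\<close>, the second for the \<open>I\<close>
      copies of \<open>\<eta> n\<close> from the cycle.\<close>
    define e where "e n = 2 * K * c2 n + real I * (2 * K * (c3 n + c2 n))" for n
    have "e \<longlonglongrightarrow> 2 * K * 0 + real I * (2 * K * (0 + 0))"
      unfolding e_def using C2 C3 unfolding c2_def c3_def by (intro tendsto_intros)
    then show "e \<longlonglongrightarrow> 0"
      by simp
    show "0 \<le> s n" for n
      using \<gamma>[of n] by (simp add: s_def)
    show "0 \<le> \<alpha> (Suc n)" "\<alpha> (Suc n) \<le> 1" for n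
      using \<alpha>[of "Suc n"] by auto
    \<comment> \<open>The weights of the recursion are \<open>\<alpha> (Suc n)\<close>, so the term
      \<open>\<alpha> 0\<close> is removed from the divergent sum.\<close>
    have "filterlim (\<lambda>N. - \<alpha> 0 + (\<Sum>n\<le>N. \<alpha> n)) at_top sequentially"
      by (rule filterlim_tendsto_add_at_top[OF tendsto_const \<alpha>_sum])
    then show "filterlim (\<lambda>N. \<Sum>n<N. \<alpha> (Suc n)) at_top sequentially"
      by (simp add: sum.atMost_shift)
    fix n
    define g where "g = \<bar>1 / \<gamma> (Suc n) - 1 / \<gamma> n\<bar>"
    have g: "g = \<alpha> (Suc n) * c2 n"
      using \<alpha>[of "Suc n"] by (simp add: c2_def g_def)
    have "\<bar>\<alpha> (Suc n) - \<alpha> n\<bar> = \<alpha> (Suc n) * \<bar>1 - \<alpha> n / \<alpha> (Suc n)\<bar>"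
    proof -
      have "\<alpha> (Suc n) - \<alpha> n = \<alpha> (Suc n) * (1 - \<alpha> n / \<alpha> (Suc n))"
        using \<alpha>[of "Suc n"] by (simp add: right_diff_distrib)
      then show ?thesis
        using \<alpha>[of "Suc n"] by (simp only: abs_mult)
    qed
    then have da: "\<bar>\<alpha> (Suc n) - \<alpha> n\<bar> / \<gamma> (Suc n) = \<alpha> (Suc n) * c3 n"
      by (simp add: c3_def)
    \<comment> \<open>Divided by the new parameter, the relative change of \<gamma> becomes the
      difference of reciprocals controlled by \<open>C2\<close>.\<close>
    have dg: "\<bar>1 - \<gamma> (Suc n) / \<gamma> n\<bar> / \<gamma> (Suc n) = g"
    proof -
      have "(1 - \<gamma> (Suc n) / \<gamma> n) / \<gamma> (Suc n) = 1 / \<gamma> (Suc n) - 1 / \<gamma> n"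
        using \<gamma>[of "Suc n"] by (simp add: diff_divide_distrib)
      then show ?thesis
        using \<gamma>[of "Suc n"] unfolding g_def by (metis abs_divide abs_of_pos)
    qed
    have \<eta>: "\<eta> n / \<gamma> (Suc n) = \<alpha> (Suc n) * (2 * K * (c3 n + c2 n))"
    proof -
      have "\<eta> n / \<gamma> (Suc n) = 2 * K * (\<bar>\<alpha> (Suc n) - \<alpha> n\<bar> / \<gamma> (Suc n)
          + \<bar>1 - \<gamma> (Suc n) / \<gamma> n\<bar> / \<gamma> (Suc n))"
        by (simp add: \<eta>_def flip: add_divide_distrib)
      then show ?thesis
        unfolding da dg g by (simp add: algebra_simps)
    qed
    have dx: "norm (x (Suc n) - x n) \<le> 2 * K"
      using norm_triangle_ineq4[of "x (Suc n)" "x n"] K_x[of n] K_x[of "Suc n"] by linarith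
    have "norm (x (Suc n) - x n) / \<gamma> (Suc n)
        = s n + norm (x (Suc n) - x n) * (1 / \<gamma> (Suc n) - 1 / \<gamma> n)"
      by (simp add: s_def right_diff_distrib)
    also have "\<dots> \<le> s n + norm (x (Suc n) - x n) * g"
      by (intro add_left_mono mult_left_mono) (auto simp: g_def)
    also have "\<dots> \<le> s n + 2 * K * g"
      using dx by (intro add_left_mono mult_right_mono) (auto simp: g_def)
    finally have "(1 - \<alpha> (Suc n)) * (norm (x (Suc n) - x n) / \<gamma> (Suc n))
        \<le> (1 - \<alpha> (Suc n)) * (s n + 2 * K * g)"
      using \<alpha>[of "Suc n"] by (intro mult_left_mono) auto
    also have "\<dots> \<le> (1 - \<alpha> (Suc n)) * s n + 2 * K * g"
      using \<alpha>[of "Suc n"] K0 by (simp add: distrib_left mult_left_le_one_le g_def)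
    finally have main: "(1 - \<alpha> (Suc n)) * (norm (x (Suc n) - x n) / \<gamma> (Suc n))
        \<le> (1 - \<alpha> (Suc n)) * s n + 2 * K * g" .
    have "s (Suc n) \<le> ((1 - \<alpha> (Suc n)) * norm (x (Suc n) - x n) + real I * \<eta> n) / \<gamma> (Suc n)"
      using cycle[of I n] I \<gamma>[of "Suc n"] by (simp add: s_def x_Suc' divide_right_mono)
    also have "\<dots> = (1 - \<alpha> (Suc n)) * (norm (x (Suc n) - x n) / \<gamma> (Suc n))
        + real I * (\<eta> n / \<gamma> (Suc n))"
      by (simp add: add_divide_distrib)
    also have "\<dots> \<le> (1 - \<alpha> (Suc n)) * s n + 2 * K * g + real I * (\<eta> n / \<gamma> (Suc n))"
      using main by simp
    also have "\<dots> = (1 - \<alpha> (Suc n)) * s n + \<alpha> (Suc n) * e n"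
      unfolding \<eta> g e_def by (simp add: algebra_simps)
    finally show "s (Suc n) \<le> (1 - \<alpha> (Suc n)) * s n + \<alpha> (Suc n) * e n" .
  qed

  \<comment> \<open>Descent over one cycle\<close>
  have key: "\<exists>\<delta>. \<delta> \<longlonglongrightarrow> 0 \<and> (\<forall>n. gap n + 2 * \<gamma> n * (G n - F z) \<le> \<gamma> n * \<delta> n)"
    if z: "z \<in> X" for z
  proof -
    define A where "A = (\<Sum>j\<in>{1..I}. (norm (a j - z))\<^sup>2)"
    define R where "R = 2 * K + 2 * norm z"
    \<comment> \<open>The errors after division by \<open>\<gamma> n\<close>: the first summand
      stems from the change of \<open>|x n - z|^2\<close> over the cycle, where \<open>R\<close>
      bounds the sum of the two distances, the second from the anchors.\<close>
    define \<delta> where "\<delta> n = R * s n + \<alpha> n / \<gamma> n * A" for n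
    have "\<delta> \<longlonglongrightarrow> R * 0 + 0 * A"
      unfolding \<delta>_def by (intro tendsto_intros s C5)
    moreover have "gap n + 2 * \<gamma> n * (G n - F z) \<le> \<gamma> n * \<delta> n" for n
    proof -
      \<comment> \<open>The output of each step is the input of the next, so chaining
        \<open>halpern_prox_step\<close> telescopes the squared distances; \<open>k = I\<close> is
        the full cycle.\<close>
      have "(norm (xi n k - z))\<^sup>2 + (\<Sum>j\<in>{1..k}. (norm (xi n (j - 1) - yi n j))\<^sup>2
            + (norm (yi n j - T j (yi n j)))\<^sup>2)
          \<le> (norm (x n - z))\<^sup>2 + (\<Sum>j\<in>{1..k}. 2 * \<gamma> n * (f j z - f j (yi n j)))
            + (\<Sum>j\<in>{1..k}. \<alpha> n * (norm (a j - z))\<^sup>2)" if "k \<le> I" for k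
        using that
      proof (induction k)
        case 0
        then show ?case
          by (simp add: xi_0)
      next
        case (Suc k)
        then have j: "Suc k \<in> {1..I}"
          by simp
        have "(norm (xi n (Suc k) - z))\<^sup>2 + ((norm (xi n (Suc k - 1) - yi n (Suc k)))\<^sup>2
              + (norm (yi n (Suc k) - T (Suc k) (yi n (Suc k))))\<^sup>2)
            \<le> (norm (xi n (Suc k - 1) - z))\<^sup>2 + 2 * \<gamma> n * (f (Suc k) z - f (Suc k) (yi n (Suc k)))
              + \<alpha> n * (norm (a (Suc k) - z))\<^sup>2"
          using \<alpha>[of n] by (intro halpern_prox_step[OF T[OF j] Fix_T[OF z j] f_convex[OF j]
              f_continuous[OF j] \<gamma> _ _ yi[OF j] xi[OF j]]) auto
        then show ?case
          using Suc by simp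
      qed
      from this[of I] have "(norm (x (Suc n) - z))\<^sup>2 + gap n
          \<le> (norm (x n - z))\<^sup>2 + 2 * \<gamma> n * (F z - G n) + \<alpha> n * A"
        by (simp add: x_Suc' gap_def F_def G_def A_def sum_subtractf
            flip: sum_distrib_left)
      moreover have "(norm (x n - z))\<^sup>2 - (norm (x (Suc n) - z))\<^sup>2 \<le> \<gamma> n * (R * s n)"
      proof -
        have "(norm (x n - z))\<^sup>2 - (norm (x (Suc n) - z))\<^sup>2
            = (norm (x n - z) - norm (x (Suc n) - z)) * (norm (x n - z) + norm (x (Suc n) - z))"
          by (simp add: power2_eq_square algebra_simps)
        also have "\<dots> \<le> norm (x (Suc n) - x n) * R"
        proof (intro mult_mono)
          show "norm (x n - z) - norm (x (Suc n) - z) \<le> norm (x (Suc n) - x n)"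
            using norm_triangle_ineq2[of "x n - z" "x (Suc n) - z"]
            by (simp add: norm_minus_commute)
          show "norm (x n - z) + norm (x (Suc n) - z) \<le> R"
            using norm_triangle_ineq4[of "x n" z] norm_triangle_ineq4[of "x (Suc n)" z]
              K_x[of n] K_x[of "Suc n"] by (simp add: R_def)
        qed auto
        also have "\<dots> = \<gamma> n * (R * s n)"
          using \<gamma>[of n] by (simp add: s_def)
        finally show ?thesis .
      qed
      moreover have "\<gamma> n * \<delta> n = \<gamma> n * (R * s n) + \<alpha> n * A"
        using \<gamma>[of n] by (simp add: \<delta>_def distrib_left)
      ultimately show ?thesis
        by (simp add: algebra_simps)
    qed
    ultimately show ?thesis
      by auto
  qed

  \<comment> \<open>Vanishing gaps and asymptotic agreement of the sequences\<close>
  have "\<exists>m. \<forall>n. m \<le> f j (yi n j)" if j: "j \<in> {1..I}" for j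
    using convex_on_continuous_bounded_below[OF f_convex[OF j] f_continuous[OF j] yi_bounded[OF j]]
    by (metis rangeI)
  then obtain m where m: "\<And>j n. j \<in> {1..I} \<Longrightarrow> m j \<le> f j (yi n j)"
    by metis
  have gap: "gap \<longlonglongrightarrow> 0"
  proof -
    obtain \<delta> where \<delta>: "\<delta> \<longlonglongrightarrow> 0"
      "\<And>n. gap n + 2 * \<gamma> n * (G n - F z0) \<le> \<gamma> n * \<delta> n"
      using key[OF z0] by blast
    define L where "L = sum m {1..I}"
    \<comment> \<open>\<open>G n\<close> may fall below \<open>F z0\<close>; the uniform lower bound
      \<open>L\<close> limits this shortfall, so \<open>gap n\<close> is at most
      \<open>\<gamma> n\<close> times a convergent sequence.\<close>
    have le: "gap n \<le> \<gamma> n * (\<delta> n + 2 * (F z0 - L))" for n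
    proof -
      have "L \<le> G n"
        unfolding L_def G_def using m by (intro sum_mono) blast
      then have "\<gamma> n * L \<le> \<gamma> n * G n"
        using \<gamma>[of n] by simp
      then show ?thesis
        using \<delta>(2)[of n] by (simp add: algebra_simps)
    qed
    have "(\<lambda>n. \<gamma> n * (\<delta> n + 2 * (F z0 - L))) \<longlonglongrightarrow> 0 * (0 + 2 * (F z0 - L))"
      by (intro tendsto_intros \<gamma>_lim \<delta>(1))
    then have lim: "(\<lambda>n. \<gamma> n * (\<delta> n + 2 * (F z0 - L))) \<longlonglongrightarrow> 0"
      by simp
    show ?thesis
    proof (rule Lim_null_comparison[OF _ lim])
      show "\<forall>\<^sub>F n in sequentially. norm (gap n) \<le> \<gamma> n * (\<delta> n + 2 * (F z0 - L))"
        using le gap_nonneg by simp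
    qed
  qed
  then have sqrt_gap: "(\<lambda>n. sqrt (gap n)) \<longlonglongrightarrow> 0"
    using tendsto_real_sqrt by force
  have x_y: "(\<lambda>n. xi n (j - 1) - yi n j) \<longlonglongrightarrow> 0"
    and y_T: "(\<lambda>n. yi n j - T j (yi n j)) \<longlonglongrightarrow> 0" if j: "j \<in> {1..I}" for j
  proof -
    have "(norm (xi n (j - 1) - yi n j))\<^sup>2 + (norm (yi n j - T j (yi n j)))\<^sup>2 \<le> gap n" for n
      unfolding gap_def using j
      by (intro member_le_sum[where f = "\<lambda>j. (norm (xi n (j - 1) - yi n j))\<^sup>2
          + (norm (yi n j - T j (yi n j)))\<^sup>2"]) auto
    then have "(norm (xi n (j - 1) - yi n j))\<^sup>2 \<le> gap n" "(norm (yi n j - T j (yi n j)))\<^sup>2 \<le> gap n"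
      for n
      by (smt (verit) zero_le_power2)+
    then show "(\<lambda>n. xi n (j - 1) - yi n j) \<longlonglongrightarrow> 0" "(\<lambda>n. yi n j - T j (yi n j)) \<longlonglongrightarrow> 0"
      by (intro Lim_null_comparison[OF _ sqrt_gap] always_eventually allI real_le_rsqrt; simp)+
  qed
  have xi_T: "(\<lambda>n. xi n j - T j (yi n j)) \<longlonglongrightarrow> 0" if j: "j \<in> {1..I}" for j
  proof (rule Lim_null_comparison)
    have "(\<lambda>n. \<alpha> n * (2 * K)) \<longlonglongrightarrow> 0 * (2 * K)"
      by (intro tendsto_intros \<alpha>_lim)
    then show "(\<lambda>n. \<alpha> n * (2 * K)) \<longlonglongrightarrow> 0"
      by simp
    have "norm (xi n j - T j (yi n j)) \<le> \<alpha> n * (2 * K)" for n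
    proof -
      have "xi n j - T j (yi n j) = \<alpha> n *\<^sub>R (a j - T j (yi n j))"
        unfolding xi[OF j] by (simp add: algebra_simps)
      moreover have "norm (a j - T j (yi n j)) \<le> 2 * K"
        using norm_triangle_ineq4[of "a j" "T j (yi n j)"] K_a[OF j] K_T[OF j, of n] by linarith
      ultimately show ?thesis
        using \<alpha>[of n] by simp
    qed
    then show "\<forall>\<^sub>F n in sequentially. norm (xi n j - T j (yi n j)) \<le> \<alpha> n * (2 * K)"
      by simp
  qed
  \<comment> \<open>Passing from \<open>xi n j\<close> to \<open>xi n (Suc j)\<close> goes through
    \<open>yi n (Suc j)\<close> and its image under \<open>T (Suc j)\<close>, and all three
    differences vanish.\<close>
  have xi_x: "(\<lambda>n. xi n j - x n) \<longlonglongrightarrow> 0" if "j \<le> I" for j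
    using that
  proof (induction j)
    case 0
    then show ?case
      by (simp add: xi_0)
  next
    case (Suc j)
    then have j: "Suc j \<in> {1..I}"
      by simp
    have "(\<lambda>n. (xi n j - x n) - (xi n (Suc j - 1) - yi n (Suc j))
          - (yi n (Suc j) - T (Suc j) (yi n (Suc j)))
          + (xi n (Suc j) - T (Suc j) (yi n (Suc j)))) \<longlonglongrightarrow> 0 - 0 - 0 + 0"
      by (intro tendsto_add tendsto_diff x_y[OF j] y_T[OF j] xi_T[OF j]) (use Suc in auto)
    then show ?case
      by simp
  qed
  have y_x: "(\<lambda>n. yi n j - x n) \<longlonglongrightarrow> 0" if j: "j \<in> {1..I}" for j
  proof -
    have "(\<lambda>n. (xi n (j - 1) - x n) - (xi n (j - 1) - yi n j)) \<longlonglongrightarrow> 0 - 0"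
      by (intro tendsto_diff xi_x x_y[OF j]) (use j in auto)
    then show ?thesis
      by simp
  qed

  \<comment> \<open>Weak cluster points are minimizers\<close>
  show ?thesis
  proof (intro ballI allI impI)
    fix i p
    assume i: "i \<in> {1..I}" and "weak_seq_cluster_point (\<lambda>n. xi n i) p"
    then obtain r :: "nat \<Rightarrow> nat"
      where r: "strict_mono r" and weak: "weakly_converges (\<lambda>k. xi (r k) i) p"
      by (auto simp: weak_seq_cluster_point_def o_def)
    \<comment> \<open>The cluster point comes from the single index \<open>i\<close>, but along the
      same subsequence every \<open>yi\<close> has the same weak limit.\<close>
    have weak_y: "weakly_converges (\<lambda>k. yi (r k) j) p" if j: "j \<in> {1..I}" for j
    proof (rule weakly_converges_perturb[OF weak])
      have "(\<lambda>n. (yi n j - x n) - (xi n i - x n)) \<longlonglongrightarrow> 0 - 0"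
        by (intro tendsto_diff y_x[OF j] xi_x) (use i in auto)
      then have "(\<lambda>n. yi n j - xi n i) \<longlonglongrightarrow> 0"
        by simp
      from LIMSEQ_subseq_LIMSEQ[OF this r] show "(\<lambda>k. yi (r k) j - xi (r k) i) \<longlonglongrightarrow> 0"
        by (simp add: o_def)
    qed
    have "p \<in> Fix (T j)" if j: "j \<in> {1..I}" for j
    proof (rule firmly_nonexpansive_demiclosed[OF T[OF j] weak_y[OF j]])
      show "bounded (range (\<lambda>k. yi (r k) j))"
        by (rule bounded_subset[OF yi_bounded[OF j]]) auto
      show "(\<lambda>k. yi (r k) j - T j (yi (r k) j)) \<longlonglongrightarrow> 0"
        using LIMSEQ_subseq_LIMSEQ[OF y_T[OF j] r] by (simp add: o_def)
    qed
    then have "p \<in> X"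
      using X by blast
    moreover have "F p \<le> F z" if z: "z \<in> X" for z
    proof (rule field_le_epsilon)
      fix e :: real
      assume e: "0 < e"
      obtain \<delta> where \<delta>: "\<delta> \<longlonglongrightarrow> 0" "\<And>n. gap n + 2 * \<gamma> n * (G n - F z) \<le> \<gamma> n * \<delta> n"
        using key[OF z] by blast
      \<comment> \<open>The nonnegative gap is dropped before dividing by
        \<open>2 * \<gamma> n\<close>; this is where an error of order o(\<gamma>) matters.\<close>
      have G: "G n \<le> F z + \<delta> n / 2" for n
      proof -
        have "\<gamma> n * (2 * (G n - F z)) \<le> \<gamma> n * \<delta> n"
          using \<delta>(2)[of n] gap_nonneg[of n] by (simp add: mult.assoc mult.left_commute)
        then have "2 * (G n - F z) \<le> \<delta> n"
          using \<gamma>[of n] by simp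
        then show ?thesis
          by (simp add: field_simps)
      qed
      \<comment> \<open>The tolerance \<open>e\<close> is shared equally among the \<open>I\<close>
        functions, each being weakly lower semicontinuous at \<open>p\<close>.\<close>
      have "\<forall>\<^sub>F k in sequentially. \<forall>j\<in>{1..I}. f j p - e / real I < f j (yi (r k) j)"
        using e I
        by (auto intro!: eventually_ball_finite
            convex_on_continuous_weakly_lsc[OF f_convex f_continuous weak_y])
      then have "\<forall>\<^sub>F k in sequentially. F p - e \<le> F z + \<delta> (r k) / 2"
      proof (rule eventually_mono)
        fix k
        assume "\<forall>j\<in>{1..I}. f j p - e / real I < f j (yi (r k) j)"
        then have "(\<Sum>j\<in>{1..I}. f j p - e / real I) \<le> G (r k)"
          unfolding G_def by (intro sum_mono less_imp_le) blast
        moreover have "(\<Sum>j\<in>{1..I}. f j p - e / real I) = F p - e"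
          using I by (simp add: F_def sum_subtractf)
        ultimately show "F p - e \<le> F z + \<delta> (r k) / 2"
          using G[of "r k"] by simp
      qed
      moreover have "(\<lambda>k. F z + \<delta> (r k) / 2) \<longlonglongrightarrow> F z + 0 / 2"
        using LIMSEQ_subseq_LIMSEQ[OF \<delta>(1) r] by (intro tendsto_intros) (auto simp: o_def)
      ultimately have "F p - e \<le> F z + 0 / 2"
        by (intro tendsto_lowerbound) auto
      then show "F p \<le> F z + e"
        by simp
    qed
    ultimately show "p \<in> minimizers_on (\<lambda>z. \<Sum>j\<in>{1..I}. f j z) X"
      by (simp add: minimizers_on_def F_def)
  qed
qed

end
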